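(* Let $d\geq 1$ be an integer and let $w\geq 2d-1$ be a real number. Then there exist uncountably many $\xi\in\mathbb{F}_q((T^{-1}))$ such that \[ w_1(\xi)=w_1^{*}(\xi)=\ldots=w_d(\xi)=w_d^{*}(\xi)=w . \]
   Context: Let $p$ be a prime and $q$ a power of $p$. $\mathbb{F}_q((T^{-1}))$ is the field of Laurent series $\xi=\sum_{n\geq N}a_nT^{-n}$ ($a_n\in\mathbb{F}_q$), with absolute value $|0|=0$ and $|\xi|=q^{-N}$ if $a_N\neq 0$; this absolute value is extended uniquely to an algebraic closure $\overline{\mathbb{F}_q(T)}$. The height $H(P)$ of $P\in(\mathbb{F}_q[T])[X]$ is the maximum of the absolute values of its coefficients. Every $\alpha\in\overline{\mathbb{F}_q(T)}$ is a root of a unique non-constant, irreducible, primitive $P\in(\mathbb{F}_q[T])[X]$ whose leading coefficient is monic in $T$; $H(\alpha)$ and $\deg\alpha$ denote the height and degree of this polynomial. For $\xi\in\mathbb{F}_q((T^{-1}))$ and $n\geq1$, $w_n(\xi)$ is the supremum of real $w$ such that $0<|P(\xi)|\leq H(P)^{-w}$ for infinitely many $P\in(\mathbb{F}_q[T])[X]$ of degree at most $n$, and $w_n^{*}(\xi)$ is the supremum of real $w^*$ such that $0<|\xi-\alpha|\leq H(\alpha)^{-w^*-1}$ for infinitely many $\alpha\in\overline{\mathbb{F}_q(T)}$ of degree at most $n$. *)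

theory Defs
  imports
    "HOL-Algebra.Algebraic_Closure_Type"
    "HOL-Computational_Algebra.Formal_Laurent_Series"
    "HOL-Library.Cardinality"
    "HOL-Library.Countable_Set"
    "HOL-Library.Extended_Real"
begin

text \<open>
  The finite field \<open>\<bbbF>\<^sub>q\<close> is a type \<open>'a :: {field, finite}\<close> with \<open>q = CARD('a)\<close>.
  The field \<open>\<bbbF>\<^sub>q((T\<inverse>))\<close> is \<open>'a fls\<close>, whose formal variable plays the role of \<open>T\<inverse>\<close>;
  thus \<open>T\<close> is \<^const>\<open>fls_X_inv\<close>. The ring \<open>(\<bbbF>\<^sub>q[T])[X]\<close> is \<open>'a poly poly\<close>, the inner
  variable being \<open>T\<close>.
\<close>

definition fls_abs :: "'a :: {field, finite} fls \<Rightarrow> real" where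
  "fls_abs \<xi> = (if \<xi> = 0 then 0 else real CARD('a) powr (- real_of_int (fls_subdegree \<xi>)))"

definition fls_of_poly_T :: "'a :: field poly \<Rightarrow> 'a fls" where
  "fls_of_poly_T A = poly (map_poly fls_const A) fls_X_inv"

definition eval_fls :: "'a :: field poly poly \<Rightarrow> 'a fls \<Rightarrow> 'a fls" where
  "eval_fls P \<xi> = poly (map_poly fls_of_poly_T P) \<xi>"

definition eval_ac :: "'a :: field poly poly \<Rightarrow> 'a fls alg_closure \<Rightarrow> 'a fls alg_closure" where
  "eval_ac P \<alpha> = poly (map_poly (\<lambda>A. to_ac (fls_of_poly_T A)) P) \<alpha>"

definition height :: "'a :: {field, finite} poly poly \<Rightarrow> real" where
  "height P = Max ((\<lambda>i. fls_abs (fls_of_poly_T (coeff P i))) ` {..degree P})"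

text \<open>
  An algebraic closure of \<open>\<bbbF>\<^sub>q(T)\<close>, realised as the set of elements of an algebraic closure
  of \<open>\<bbbF>\<^sub>q((T\<inverse>))\<close> that are algebraic over \<open>\<bbbF>\<^sub>q(T)\<close>; in this way \<open>\<xi> - \<alpha>\<close> makes sense
  for \<open>\<xi>\<close> in \<open>\<bbbF>\<^sub>q((T\<inverse>))\<close>.
\<close>

definition FqT_closure :: "'a :: field fls alg_closure set" where
  "FqT_closure = {\<alpha>. \<exists>P. P \<noteq> 0 \<and> eval_ac P \<alpha> = 0}"

text \<open>Any such extension is unique, since \<open>\<bbbF>\<^sub>q((T\<inverse>))\<close> is complete.\<close>

definition extends_fls_abs :: "('a :: {field, finite} fls alg_closure \<Rightarrow> real) \<Rightarrow> bool" where
  "extends_fls_abs v \<longleftrightarrow>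
     (\<forall>x. v x \<ge> 0) \<and> (\<forall>x. v x = 0 \<longleftrightarrow> x = 0) \<and>
     (\<forall>x y. v (x * y) = v x * v y) \<and>
     (\<forall>x y. v (x + y) \<le> v x + v y) \<and>
     (\<forall>\<xi>. v (to_ac \<xi>) = fls_abs \<xi>)"

definition primitive_poly :: "'a :: comm_semiring_1 poly \<Rightarrow> bool" where
  "primitive_poly P \<longleftrightarrow> (\<forall>c. (\<forall>i. c dvd coeff P i) \<longrightarrow> c dvd 1)"

definition is_defining_poly :: "'a :: field poly poly \<Rightarrow> 'a fls alg_closure \<Rightarrow> bool" where
  "is_defining_poly P \<alpha> \<longleftrightarrow>
     degree P > 0 \<and> irreducible P \<and> primitive_poly P \<and> lead_coeff (lead_coeff P) = 1 \<and>
     eval_ac P \<alpha> = 0"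

definition defining_poly :: "'a :: field fls alg_closure \<Rightarrow> 'a poly poly" where
  "defining_poly \<alpha> = (THE P. is_defining_poly P \<alpha>)"

definition alg_height :: "'a :: {field, finite} fls alg_closure \<Rightarrow> real" where
  "alg_height \<alpha> = height (defining_poly \<alpha>)"

definition alg_degree :: "'a :: field fls alg_closure \<Rightarrow> nat" where
  "alg_degree \<alpha> = degree (defining_poly \<alpha>)"

text \<open>The exponents are extended reals, as the suprema may be infinite.\<close>

definition w_exp :: "nat \<Rightarrow> 'a :: {field, finite} fls \<Rightarrow> ereal" where
  "w_exp n \<xi> = Sup {ereal w | w :: real.
     infinite {P :: 'a poly poly. degree P \<le> n \<and>
       0 < fls_abs (eval_fls P \<xi>) \<and> fls_abs (eval_fls P \<xi>) \<le> height P powr (- w)}}"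

definition w_star_exp ::
  "('a :: {field, finite} fls alg_closure \<Rightarrow> real) \<Rightarrow> nat \<Rightarrow> 'a fls \<Rightarrow> ereal" where
  "w_star_exp v n \<xi> = Sup {ereal w | w :: real.
     infinite {\<alpha> \<in> FqT_closure. alg_degree \<alpha> \<le> n \<and>
       0 < v (to_ac \<xi> - \<alpha>) \<and> v (to_ac \<xi> - \<alpha>) \<le> alg_height \<alpha> powr (- w - 1)}}"

end

theory Submission
  imports Defs
begin

text \<open>
  Take \<open>\<xi> = [0; a\<^sub>0, a\<^sub>1, \<dots>]\<close> with convergents \<open>p\<^sub>k / q\<^sub>k\<close> such that \<open>deg q\<^bsub>k+1\<^esub> - w deg q\<^sub>k\<close>
  lies between 0 and 1. Then \<open>|\<xi> - p\<^sub>k / q\<^sub>k| \<le> |q\<^sub>k|\<^bsup>-w-1\<^esup>\<close>, which gives the lower bounds for all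
  exponents.

  For the upper bounds one shows \<open>|P(\<xi>)| \<ge> c H(P)\<^bsup>-w\<^esup>\<close> for all \<open>P \<noteq> 0\<close> of degree at most \<open>n \<le> d\<close>.
  Let \<open>k\<close> be minimal such that \<open>H(P) < |q\<^sub>k|\<^bsup>w+1-n\<^esup>\<close>. If \<open>P(p\<^sub>k / q\<^sub>k) \<noteq> 0\<close>, the absolute value of
  \<open>P(p\<^sub>k / q\<^sub>k)\<close> is at least \<open>|q\<^sub>k|\<^bsup>-n\<^esup>\<close>, the ultrametric inequality transfers the bound to \<open>P(\<xi>)\<close>,
  and minimality of \<open>k\<close> together with \<open>n \<le> w + 1 - n\<close> turns it into a bound in terms of \<open>H(P)\<close>.
  Otherwise \<open>q\<^sub>k X - p\<^sub>k\<close> divides \<open>P\<close> and one argues by induction on the degree, heights being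
  multiplicative. The defining polynomial \<open>P\<close> of \<open>\<alpha>\<close> satisfies \<open>|P(\<xi>)| \<le> C H(P) |\<xi> - \<alpha>|\<close> when \<open>\<alpha>\<close> is
  close to \<open>\<xi>\<close>, which settles the starred exponents.

  At each step one of two partial quotients of the same degree may be chosen, and different choices
  give different \<open>\<xi>\<close>.
\<close>

section \<open>The absolute value and evaluation\<close>

lemma fls_of_poly_T_0 [simp]: "fls_of_poly_T 0 = 0"
  by (simp add: fls_of_poly_T_def)

lemma fls_of_poly_T_pCons:
  "fls_of_poly_T (pCons a A) = fls_const a + fls_X_inv * fls_of_poly_T A"
  by (simp add: fls_of_poly_T_def map_poly_pCons)

lemma fls_of_poly_T_1 [simp]: "fls_of_poly_T 1 = 1"
  by (simp add: fls_of_poly_T_def)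

lemma fls_of_poly_T_add [simp]:
  "fls_of_poly_T (A + B) = fls_of_poly_T A + fls_of_poly_T B"
proof (induction A B rule: poly_induct2)
  case (pCons a A b B)
  then show ?case
    by (simp add: fls_of_poly_T_pCons algebra_simps fls_plus_const [symmetric])
qed simp

lemma fls_of_poly_T_smult: "fls_of_poly_T (smult c A) = fls_const c * fls_of_poly_T A"
  by (induction A) (simp_all add: fls_of_poly_T_pCons algebra_simps)

lemma fls_of_poly_T_mult [simp]:
  "fls_of_poly_T (A * B) = fls_of_poly_T A * fls_of_poly_T B"
  by (induction A)
    (simp_all add: fls_of_poly_T_pCons fls_of_poly_T_smult algebra_simps)

lemma fls_of_poly_T_uminus [simp]: "fls_of_poly_T (- A) = - fls_of_poly_T A"
  using fls_of_poly_T_add [of A "- A"] by (simp add: eq_neg_iff_add_eq_0 add.commute)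

lemma fls_of_poly_T_diff [simp]:
  "fls_of_poly_T (A - B) = fls_of_poly_T A - fls_of_poly_T B"
  using fls_of_poly_T_add [of A "- B"] by simp

lemma fls_of_poly_T_power [simp]: "fls_of_poly_T (A ^ n) = fls_of_poly_T A ^ n"
  by (induction n) simp_all

text \<open>The formal variable of the series is the inverse of T, so the coefficient of T^m sits at
  index -m.\<close>

lemma fls_of_poly_T_nth:
  "fls_nth (fls_of_poly_T A) n = (if n \<le> 0 then coeff A (nat (- n)) else 0)"
proof (induction A arbitrary: n)
  case (pCons a A)
  have *: "nat (- n) = Suc (nat (- n - 1))" if "n < 0"
    using that by simp
  show ?case
    using pCons.IH [of "n + 1"]
    by (auto simp: fls_of_poly_T_pCons fls_X_inv_times_conv_shift coeff_pCons * split: nat.split)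
qed simp

lemma fls_of_poly_T_eq_0_iff [simp]: "fls_of_poly_T A = 0 \<longleftrightarrow> A = 0"
proof
  assume "fls_of_poly_T A = 0"
  then have "coeff A n = 0" for n
    using fls_of_poly_T_nth [of A "- int n"] by simp
  then show "A = 0"
    by (simp add: poly_eq_iff)
qed simp

text \<open>This covers A = 0 too, since the degree and the subdegree of 0 are both 0 by
  convention.\<close>

lemma fls_subdegree_of_poly_T:
  "fls_subdegree (fls_of_poly_T A) = - int (degree A)"
proof (cases "A = 0")
  case False
  then show ?thesis
    by (intro fls_subdegree_eqI) (auto simp: fls_of_poly_T_nth coeff_eq_0)
qed simp

section \<open>The ultrametric absolute value\<close>

lemma fls_abs_nonneg [simp]: "fls_abs x \<ge> 0"
  by (simp add: fls_abs_def)

lemma fls_abs_0 [simp]: "fls_abs 0 = 0"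
  by (simp add: fls_abs_def)

lemma CARD_field_gt_1: "CARD('a :: {field, finite}) > 1"
proof -
  have "card {0, 1 :: 'a} \<le> CARD('a)"
    by (rule card_mono) auto
  then show ?thesis
    by simp
qed

lemma fls_abs_eq_0_iff [simp]: "fls_abs x = 0 \<longleftrightarrow> x = 0"
  by (simp add: fls_abs_def)

lemma fls_abs_pos_iff [simp]: "fls_abs x > 0 \<longleftrightarrow> x \<noteq> 0"
  by (simp add: fls_abs_def)

lemma fls_abs_1 [simp]: "fls_abs 1 = 1"
  by (simp add: fls_abs_def)

lemma fls_abs_mult [simp]: "fls_abs (x * y) = fls_abs x * fls_abs y"
  by (simp add: fls_abs_def powr_add [symmetric])

lemma fls_abs_power [simp]: "fls_abs (x ^ n) = fls_abs x ^ n"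
  by (induction n) simp_all

lemma fls_abs_divide [simp]: "fls_abs (x / y) = fls_abs x / fls_abs y"
proof (cases "y = 0")
  case False
  then have "fls_abs x = fls_abs (x / y) * fls_abs y"
    by (simp flip: fls_abs_mult)
  with False show ?thesis
    by (simp add: field_simps)
qed simp

lemma fls_abs_uminus [simp]: "fls_abs (- x) = fls_abs x"
  by (simp add: fls_abs_def)

lemma fls_abs_add_le: "fls_abs (x + y) \<le> max (fls_abs x) (fls_abs y)"
proof (cases "x = 0 \<or> y = 0 \<or> x + y = 0")
  case True
  then show ?thesis
    by (auto simp: le_max_iff_disj)
next
  case False
  have "min (fls_subdegree x) (fls_subdegree y) \<le> fls_subdegree (x + y)"
    using False by (intro fls_plus_subdegree) simp
  then show ?thesis
    using False CARD_field_gt_1 [where 'a = 'a]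
    by (auto simp: fls_abs_def le_max_iff_disj min_le_iff_disj)
qed

lemma fls_abs_diff_le: "fls_abs (x - y) \<le> max (fls_abs x) (fls_abs y)"
  using fls_abs_add_le [of x "- y"] by simp

text \<open>If x + y were smaller than x, then x = (x + y) - y would be a difference of two elements
  smaller than x.\<close>

lemma fls_abs_add_eq: "fls_abs y < fls_abs x \<Longrightarrow> fls_abs (x + y) = fls_abs x"
  using fls_abs_add_le [of x y] fls_abs_diff_le [of "x + y" y] by (simp split: if_splits add: max_def)

lemma fls_abs_of_poly_T:
  "A \<noteq> 0 \<Longrightarrow> fls_abs (fls_of_poly_T A :: 'a :: {field, finite} fls) = real CARD('a) ^ degree A"
  using CARD_field_gt_1 [where 'a = 'a]
  by (simp add: fls_abs_def fls_subdegree_of_poly_T powr_realpow)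

text \<open>The analogue of a nonzero integer having absolute value at least 1; lower bounds for
  values at fractions rest on it.\<close>

lemma fls_abs_of_poly_T_ge_1: "A \<noteq> 0 \<Longrightarrow> fls_abs (fls_of_poly_T A) \<ge> 1"
  using CARD_field_gt_1 [where 'a = 'a] by (simp add: fls_abs_of_poly_T)

section \<open>Evaluation as a ring homomorphism\<close>

lemma eval_ac_0 [simp]: "eval_ac 0 \<alpha> = 0"
  by (simp add: eval_ac_def)

lemma eval_ac_pCons: "eval_ac (pCons A P) \<alpha> = to_ac (fls_of_poly_T A) + \<alpha> * eval_ac P \<alpha>"
  by (simp add: eval_ac_def map_poly_pCons)

lemma eval_ac_add [simp]: "eval_ac (P + R) \<alpha> = eval_ac P \<alpha> + eval_ac R \<alpha>"
  by (induction P R rule: poly_induct2) (simp_all add: eval_ac_pCons algebra_simps)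

lemma eval_ac_smult [simp]: "eval_ac (smult A P) \<alpha> = to_ac (fls_of_poly_T A) * eval_ac P \<alpha>"
  by (induction P) (simp_all add: eval_ac_pCons algebra_simps)

lemma eval_ac_mult [simp]: "eval_ac (P * R) \<alpha> = eval_ac P \<alpha> * eval_ac R \<alpha>"
  by (induction P) (simp_all add: eval_ac_pCons algebra_simps)

lemma eval_fls_0 [simp]: "eval_fls 0 \<xi> = 0"
  by (simp add: eval_fls_def)

lemma eval_fls_pCons: "eval_fls (pCons A P) \<xi> = fls_of_poly_T A + \<xi> * eval_fls P \<xi>"
  by (simp add: eval_fls_def map_poly_pCons)

lemma eval_ac_to_ac: "eval_ac P (to_ac \<xi>) = to_ac (eval_fls P \<xi>)"
  by (induction P) (simp_all add: eval_ac_pCons eval_fls_pCons)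

lemma eval_fls_mult [simp]: "eval_fls (P * R) \<xi> = eval_fls P \<xi> * eval_fls R \<xi>"
  using eval_ac_mult [of P R "to_ac \<xi>"] by (simp add: eval_ac_to_ac flip: to_ac_mult)

lemma finite_roots_eval_ac:
  assumes "P \<noteq> 0"
  shows "finite {\<alpha>. eval_ac P \<alpha> = 0}"
proof -
  have "map_poly (\<lambda>A. to_ac (fls_of_poly_T A)) P \<noteq> 0"
    using assms by (subst map_poly_eq_0_iff) auto
  then show ?thesis
    unfolding eval_ac_def by (rule poly_roots_finite)
qed

section \<open>Minimal polynomials\<close>

lemma field_poly_prime_divisor:
  fixes c :: "'a :: field poly"
  assumes "degree c > 0"
  shows "\<exists>\<pi>. prime_elem \<pi> \<and> \<pi> dvd c"
  using assms
proof (induction "degree c" arbitrary: c rule: less_induct)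
  case less
  show ?case
  proof (cases "irreducible c")
    case True
    then show ?thesis
      using field_poly_irreducible_imp_prime dvd_refl by metis
  next
    case False
    have "c \<noteq> 0"
      using less.prems by auto
    moreover from this have "\<not> c dvd 1"
      using less.prems by (simp add: is_unit_iff_degree)
    ultimately obtain a b where ab: "c = a * b" "\<not> a dvd 1" "\<not> b dvd 1"
      using False unfolding irreducible_def by metis
    with \<open>c \<noteq> 0\<close> have "degree a > 0" "degree a < degree c"
      by (auto simp: is_unit_iff_degree degree_mult_eq)
    with less.hyps obtain \<pi> where "prime_elem \<pi>" "\<pi> dvd a"
      by blast
    then show ?thesis
      using ab(1) dvd_mult2 by metis
  qed
qed

text \<open>Gauss's lemma: the denominator \<open>c\<close> is removed one prime factor at a time.\<close>

lemma primitive_dvd_of_dvd_smult: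
  fixes P R S :: "'a :: field poly poly"
  assumes "primitive_poly P" "c \<noteq> 0" "smult c R = P * S"
  shows "P dvd R"
  using assms(2,3)
proof (induction "degree c" arbitrary: c S rule: less_induct)
  case less
  show ?case
  proof (cases "c dvd 1")
    case True
    then obtain b where "c * b = 1"
      by (metis dvd_def)
    then have "R = P * smult b S"
      using arg_cong [OF less.prems(2), of "smult b"] by (simp add: mult.commute)
    then show ?thesis
      by (metis dvd_triv_left)
  next
    case False
    obtain \<pi> where \<pi>: "prime_elem \<pi>" "\<pi> dvd c"
      using field_poly_prime_divisor [of c] less.prems(1) False by (auto simp: is_unit_iff_degree)
    have "\<not> [:\<pi>:] dvd P"
      using assms(1) \<pi>(1) by (auto simp: primitive_poly_def const_poly_dvd_iff)
    moreover have "[:\<pi>:] dvd P * S"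
      unfolding less.prems(2) [symmetric] using \<pi>(2) by (simp add: const_poly_dvd_iff)
    ultimately have "[:\<pi>:] dvd S"
      using lift_prime_elem_poly [OF \<pi>(1)] prime_elem_dvd_mult_iff by blast
    then obtain S' where S': "S = smult \<pi> S'"
      by auto
    obtain c' where c': "c = \<pi> * c'"
      using \<pi>(2) by blast
    have nz: "\<pi> \<noteq> 0" "c' \<noteq> 0"
      using less.prems(1) c' by auto
    have "smult \<pi> (smult c' R) = smult \<pi> (P * S')"
      using less.prems(2) by (simp add: c' S')
    then have "smult c' R = P * S'"
      using nz smult_cancel by blast
    moreover have "degree \<pi> > 0"
      using \<pi>(1) nz by (metis is_unit_iff_degree not_gr0 prime_elem_not_unit)
    then have "degree c' < degree c"
      using nz by (simp add: c' degree_mult_eq)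
    ultimately show ?thesis
      using less.hyps nz by blast
  qed
qed

text \<open>The pseudo-remainder of R by P vanishes at \<alpha> and, unless zero, has smaller degree
  than P, so minimality makes it zero. Hence P divides a nonzero constant multiple of R, and Gauss's
  lemma removes the constant.\<close>

lemma primitive_dvd_of_minimal_degree:
  fixes P R :: "'a :: field poly poly"
  assumes "primitive_poly P" "P \<noteq> 0" "eval_ac P \<alpha> = 0" "eval_ac R \<alpha> = 0"
    and minimal: "\<And>S. S \<noteq> 0 \<Longrightarrow> eval_ac S \<alpha> = 0 \<Longrightarrow> degree P \<le> degree S"
  shows "P dvd R"
proof -
  obtain c S where cS: "c \<noteq> 0" "smult c R = P * S + pseudo_mod R P"
    using pseudo_mod(1) [OF assms(2)] by blast
  have "eval_ac (pseudo_mod R P) \<alpha> = 0"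
    using arg_cong [OF cS(2), of "\<lambda>S. eval_ac S \<alpha>"] assms(3,4) by simp
  then have "pseudo_mod R P = 0"
    using pseudo_mod(2) [OF assms(2), of R] minimal leD by blast
  with cS assms(1) show ?thesis
    by (auto intro: primitive_dvd_of_dvd_smult)
qed

text \<open>In a factorisation of P one factor vanishes at \<alpha> and by minimality takes up the
  whole degree. The other factor is then a constant dividing every coefficient, hence a unit because
  P is primitive.\<close>

lemma irreducible_of_minimal_degree:
  fixes P :: "'a :: field poly poly"
  assumes "primitive_poly P" "P \<noteq> 0" "eval_ac P \<alpha> = 0"
    and minimal: "\<And>S. S \<noteq> 0 \<Longrightarrow> eval_ac S \<alpha> = 0 \<Longrightarrow> degree P \<le> degree S"
  shows "irreducible P"
proof (rule irreducibleI)
  have unit: "B dvd 1" if "P = A * B" "eval_ac A \<alpha> = 0" for A B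
  proof -
    have nz: "A \<noteq> 0" "B \<noteq> 0"
      using that(1) assms(2) by auto
    have "degree B = 0"
      using minimal [OF nz(1) that(2)] nz by (simp add: that(1) degree_mult_eq)
    then obtain b where b: "B = [:b:]"
      by (elim degree_eq_zeroE)
    then have "b dvd 1"
      using assms(1) that(1) by (simp add: primitive_poly_def)
    then show ?thesis
      by (simp add: b is_unit_const_poly_iff)
  qed
  show "A dvd 1 \<or> B dvd 1" if "P = A * B" for A B
    using unit [of A B] unit [of B A] that assms(3) by (auto simp: mult.commute)
  show "\<not> P dvd 1"
    using assms(2,3) by (auto simp: is_unit_poly_iff eval_ac_pCons)
qed (use assms in auto)

lemma degree_pos_of_eval_ac_eq_0:
  "P \<noteq> 0 \<Longrightarrow> eval_ac P \<alpha> = 0 \<Longrightarrow> degree P > 0"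
  by (cases "degree P = 0") (auto elim!: degree_eq_zeroE simp: eval_ac_pCons)

text \<open>For uniqueness, P divides any other candidate R; irreducibility of R makes the cofactor
  a constant of the finite field, and the two normalised leading coefficients force it to be 1.
  Minimal degree is a criterion that is easy to check for the convergents.\<close>

lemma defining_poly_eqI:
  fixes P :: "'a :: field poly poly"
  assumes "primitive_poly P" "lead_coeff (lead_coeff P) = 1" "eval_ac P \<alpha> = 0"
    and minimal: "\<And>S. S \<noteq> 0 \<Longrightarrow> eval_ac S \<alpha> = 0 \<Longrightarrow> degree P \<le> degree S"
  shows "is_defining_poly P \<alpha>" and "defining_poly \<alpha> = P"
proof -
  have nz: "P \<noteq> 0"
    using assms(2) by auto
  show P: "is_defining_poly P \<alpha>"
    using assms nz irreducible_of_minimal_degree [OF assms(1) nz assms(3) minimal]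
    by (simp add: is_defining_poly_def degree_pos_of_eval_ac_eq_0)
  show "defining_poly \<alpha> = P"
    unfolding defining_poly_def
  proof (rule the_equality)
    fix R assume "is_defining_poly R \<alpha>"
    then have R: "irreducible R" "lead_coeff (lead_coeff R) = 1" "eval_ac R \<alpha> = 0"
      by (simp_all add: is_defining_poly_def)
    obtain U where U: "R = P * U"
      using primitive_dvd_of_minimal_degree [OF assms(1) nz assms(3) R(3) minimal] by blast
    have "\<not> P dvd 1"
      using P irreducible_not_unit by (auto simp: is_defining_poly_def)
    then have "U dvd 1"
      using irreducibleD [OF R(1) U] by blast
    then obtain u where u: "U = [:[:u:]:]"
      by (auto simp: is_unit_poly_iff)
    have "u \<noteq> 0"
      using R(2) by (auto simp: U u)
    then have "u = 1"
      using R(2) assms(2) by (simp add: U u)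
    then show "R = P"
      by (simp add: U u one_pCons [symmetric])
  qed (fact P)
qed

text \<open>Take an annihilating polynomial of least degree in X and, among those, one whose leading
  coefficient has least degree in T. A common divisor of its coefficients can be cancelled, so the
  second minimality makes it constant in T.\<close>

lemma is_defining_poly_defining_poly:
  fixes \<alpha> :: "'a :: field fls alg_closure"
  assumes "\<alpha> \<in> FqT_closure"
  shows "is_defining_poly (defining_poly \<alpha>) \<alpha>"
proof -
  let ?A = "\<lambda>P. P \<noteq> 0 \<and> eval_ac P \<alpha> = 0"
  define n where "n = (LEAST n. \<exists>P. ?A P \<and> degree P = n)"
  have "\<exists>n P. ?A P \<and> degree P = n"
    using assms by (auto simp: FqT_closure_def)
  from LeastI_ex [OF this] have ex: "\<exists>P. ?A P \<and> degree P = n"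
    by (simp only: n_def)
  have minimal: "n \<le> degree S" if "S \<noteq> 0" "eval_ac S \<alpha> = 0" for S
    unfolding n_def using that by (blast intro: Least_le)
  obtain P where P: "?A P" "degree P = n"
    and least: "\<And>S. ?A S \<Longrightarrow> degree S = n \<Longrightarrow> degree (lead_coeff P) \<le> degree (lead_coeff S)"
    using ex ex_has_least_nat [of "\<lambda>P. ?A P \<and> degree P = n" _ "\<lambda>P. degree (lead_coeff P)"]
    by blast
  have prim: "c dvd 1" if c: "\<And>i. c dvd coeff P i" for c
  proof -
    from c have "[:c:] dvd P"
      by (simp add: const_poly_dvd_iff)
    then obtain S where S: "P = smult c S"
      by auto
    have nz: "c \<noteq> 0" "S \<noteq> 0"
      using P(1) S by auto
    then have "eval_ac S \<alpha> = 0" "degree S = n"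
      using P by (auto simp: S)
    then have "degree (lead_coeff P) \<le> degree (lead_coeff S)"
      using least nz by blast
    then have "degree c = 0"
      using nz by (simp add: S degree_mult_eq)
    then show ?thesis
      using nz by (simp add: is_unit_iff_degree)
  qed
  \<comment> \<open>Scaling by this constant makes the leading coefficient monic in T and preserves
    primitivity and degree.\<close>
  define u where "u = inverse (lead_coeff (lead_coeff P))"
  have u: "u \<noteq> 0"
    using P(1) by (simp add: u_def)
  let ?R = "smult [:u:] P"
  have "primitive_poly ?R"
    unfolding primitive_poly_def
  proof (intro allI impI prim)
    fix c i assume *: "\<forall>i. c dvd coeff ?R i"
    then have "c dvd smult u (coeff P i)"
      by (simp add: mult_pCons_left)
    then show "c dvd coeff P i"
      using u dvd_smult_cancel by blast
  qed
  moreover have "lead_coeff (lead_coeff ?R) = 1"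
    using u P(1) by (simp add: u_def)
  moreover have "eval_ac ?R \<alpha> = 0"
    using P(1) by simp
  moreover have "degree ?R \<le> degree S" if "S \<noteq> 0" "eval_ac S \<alpha> = 0" for S
    using u P(2) minimal [OF that] by simp
  ultimately show ?thesis
    using defining_poly_eqI [of ?R \<alpha>] by metis
qed

section \<open>Heights\<close>

lemma abs_coeff_le_height: "fls_abs (fls_of_poly_T (coeff P i)) \<le> height P"
proof (cases "i \<le> degree P")
  case True
  then show ?thesis
    unfolding height_def by (intro Max_ge) auto
next
  case False
  have "fls_abs (fls_of_poly_T (coeff P 0)) \<le> height P"
    unfolding height_def by (intro Max_ge) auto
  then have "height P \<ge> 0"
    using fls_abs_nonneg order_trans by blast
  with False show ?thesis
    by (simp add: coeff_eq_0)
qed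

lemma height_attained: "\<exists>i. height P = fls_abs (fls_of_poly_T (coeff P i))"
proof -
  have "height P \<in> (\<lambda>i. fls_abs (fls_of_poly_T (coeff P i))) ` {..degree P}"
    unfolding height_def by (intro Max_in) auto
  then show ?thesis
    by blast
qed

lemma height_ge_1: "P \<noteq> 0 \<Longrightarrow> height P \<ge> 1"
  using abs_coeff_le_height [of P "degree P"] fls_abs_of_poly_T_ge_1 [of "lead_coeff P"]
  by simp

section \<open>Finiteness of polynomials of bounded degree and height\<close>

lemma finite_bounded_poly:
  fixes S :: "'a :: zero set"
  assumes "finite S"
  shows "finite {P. degree P \<le> n \<and> (\<forall>i. coeff P i \<in> S)}"
proof (rule finite_subset)
  show "{P. degree P \<le> n \<and> (\<forall>i. coeff P i \<in> S)} \<subseteq> Poly ` {xs. set xs \<subseteq> S \<and> length xs \<le> Suc n}"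
  proof
    fix P assume P: "P \<in> {P. degree P \<le> n \<and> (\<forall>i. coeff P i \<in> S)}"
    have "set (coeffs P) \<subseteq> S"
      using P by (auto simp: coeffs_def)
    moreover have "length (coeffs P) \<le> Suc n"
      using P by (cases "P = 0") (auto simp: length_coeffs_degree)
    ultimately show "P \<in> Poly ` {xs. set xs \<subseteq> S \<and> length xs \<le> Suc n}"
      by (intro image_eqI [of _ _ "coeffs P"]) auto
  qed
  show "finite (Poly ` {xs. set xs \<subseteq> S \<and> length xs \<le> Suc n})"
    using assms by (intro finite_imageI finite_lists_length_le)
qed

text \<open>A height bound limits the degree in T of all coefficients.
  \<open>finite_bounded_poly\<close> is then applied twice: over the finite field, and over the
  resulting finite set of coefficients.\<close>

lemma finite_bounded_height:
  "finite {P :: 'a :: {field, finite} poly poly. degree P \<le> n \<and> height P \<le> B}"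
proof -
  obtain m where m: "B < real CARD('a) ^ m"
    using real_arch_pow [of "real CARD('a)" B] CARD_field_gt_1 [where 'a = 'a] by auto
  let ?S = "{A :: 'a poly. degree A \<le> m \<and> (\<forall>i. coeff A i \<in> UNIV)}"
  have "coeff P i \<in> ?S" if "height P \<le> B" for P i
  proof (cases "coeff P i = 0")
    case False
    then have "real CARD('a) ^ degree (coeff P i) < real CARD('a) ^ m"
      using abs_coeff_le_height [of P i] that m by (simp add: fls_abs_of_poly_T)
    then show ?thesis
      using CARD_field_gt_1 [where 'a = 'a] by simp
  qed simp
  then have "{P :: 'a poly poly. degree P \<le> n \<and> height P \<le> B} \<subseteq>
      {P. degree P \<le> n \<and> (\<forall>i. coeff P i \<in> ?S)}"
    by blast
  then show ?thesis
    by (rule finite_subset) (intro finite_bounded_poly finite)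
qed

section \<open>Estimates for polynomial values\<close>

lemma fls_abs_eval_le:
  assumes "fls_abs x \<le> 1" "\<And>i. fls_abs (fls_of_poly_T (coeff P i)) \<le> H"
  shows "fls_abs (eval_fls P x) \<le> H"
  using assms(2)
proof (induction P)
  case (pCons A P)
  have "fls_abs (eval_fls P x) \<le> H"
    using pCons.prems [of "Suc i" for i] by (intro pCons.IH) simp
  then have "fls_abs (x * eval_fls P x) \<le> H"
    using assms(1) mult_mono [of "fls_abs x" 1 "fls_abs (eval_fls P x)" H] by simp
  moreover have "fls_abs (fls_of_poly_T A) \<le> H"
    using pCons.prems [of 0] by simp
  ultimately show ?case
    using fls_abs_add_le [of "fls_of_poly_T A" "x * eval_fls P x"] by (simp add: eval_fls_pCons)
qed simp

text \<open>Induction along Horner's scheme. The ultrametric inequality keeps the Lipschitz constant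
  equal to the coefficient bound, independently of the degree.\<close>

lemma fls_abs_eval_diff_le:
  assumes "fls_abs x \<le> 1" "fls_abs y \<le> 1" "\<And>i. fls_abs (fls_of_poly_T (coeff P i)) \<le> H"
  shows "fls_abs (eval_fls P x - eval_fls P y) \<le> H * fls_abs (x - y)"
  using assms(3)
proof (induction P)
  case 0
  then show ?case
    by simp
next
  case (pCons A P)
  have H: "fls_abs (fls_of_poly_T (coeff P i)) \<le> H" for i
    using pCons.prems [of "Suc i"] by simp
  have H0: "0 \<le> H"
    using H [of 0] fls_abs_nonneg order_trans by blast
  have "fls_abs (x * (eval_fls P x - eval_fls P y)) \<le> H * fls_abs (x - y)"
    using mult_mono [OF assms(1) pCons.IH [OF H]] H0 by simp
  moreover have "fls_abs ((x - y) * eval_fls P y) \<le> H * fls_abs (x - y)"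
    using mult_left_mono [OF fls_abs_eval_le [OF assms(2) H] fls_abs_nonneg [of "x - y"]]
    by (simp add: mult.commute)
  moreover have "eval_fls (pCons A P) x - eval_fls (pCons A P) y =
      x * (eval_fls P x - eval_fls P y) + (x - y) * eval_fls P y"
    by (simp add: eval_fls_pCons algebra_simps)
  ultimately show ?case
    using fls_abs_add_le [of "x * (eval_fls P x - eval_fls P y)" "(x - y) * eval_fls P y"] by simp
qed

text \<open>Clearing denominators. The exponent n varies in the induction because each Horner step
  uses up one power of B.\<close>

lemma eval_fls_fraction:
  assumes "B \<noteq> 0" "degree P \<le> n"
  shows "\<exists>C. fls_of_poly_T B ^ n * eval_fls P (fls_of_poly_T A / fls_of_poly_T B) = fls_of_poly_T C"
  using assms(2)
proof (induction P arbitrary: n)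
  case 0
  then show ?case
    by (metis eval_fls_0 fls_of_poly_T_0 mult_zero_right)
next
  case (pCons D P)
  show ?case
  proof (cases n)
    case 0
    with pCons have "P = 0"
      by (auto split: if_splits)
    then have "fls_of_poly_T B ^ n * eval_fls (pCons D P) (fls_of_poly_T A / fls_of_poly_T B) =
        fls_of_poly_T D"
      by (simp add: 0 eval_fls_pCons)
    then show ?thesis
      by blast
  next
    case (Suc m)
    with pCons.prems have "degree P \<le> m"
      by (auto split: if_splits)
    then obtain C where C: "fls_of_poly_T B ^ m * eval_fls P (fls_of_poly_T A / fls_of_poly_T B) =
        fls_of_poly_T C"
      using pCons.IH by blast
    have "fls_of_poly_T B ^ n * eval_fls (pCons D P) (fls_of_poly_T A / fls_of_poly_T B) =
        fls_of_poly_T B ^ n * fls_of_poly_T D + fls_of_poly_T A *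
        (fls_of_poly_T B ^ m * eval_fls P (fls_of_poly_T A / fls_of_poly_T B))"
      using assms(1) by (simp add: Suc eval_fls_pCons field_simps)
    also have "\<dots> = fls_of_poly_T (B ^ n * D + A * C)"
      by (simp add: C)
    finally show ?thesis
      by blast
  qed
qed

text \<open>Liouville's argument: after clearing denominators the value is a nonzero polynomial in
  T.\<close>

lemma abs_eval_fraction_ge:
  assumes "B \<noteq> 0" "degree P \<le> n" "eval_fls P (fls_of_poly_T A / fls_of_poly_T B) \<noteq> 0"
  shows "fls_abs (eval_fls P (fls_of_poly_T A / fls_of_poly_T B)) \<ge> 1 / fls_abs (fls_of_poly_T B) ^ n"
proof -
  obtain C where C: "fls_of_poly_T B ^ n * eval_fls P (fls_of_poly_T A / fls_of_poly_T B) =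
      fls_of_poly_T C"
    using eval_fls_fraction [OF assms(1,2)] by blast
  then have "C \<noteq> 0"
    using assms(1,3) by auto
  then have "1 \<le> fls_abs (fls_of_poly_T C)"
    by (rule fls_abs_of_poly_T_ge_1)
  also have "\<dots> = fls_abs (fls_of_poly_T B) ^ n *
      fls_abs (eval_fls P (fls_of_poly_T A / fls_of_poly_T B))"
    by (simp flip: C)
  finally show ?thesis
    using assms(1) by (simp add: divide_le_eq mult.commute)
qed

text \<open>Let R attain its height at index i. In coefficient i + 1 of the product the term B *
  \<open>coeff R i\<close> strictly dominates the other one because |A| < |B|. Only this half of the
  multiplicativity of heights is used.\<close>

lemma height_linear_mult_ge:
  assumes "fls_abs (fls_of_poly_T A) < fls_abs (fls_of_poly_T B)"
  shows "fls_abs (fls_of_poly_T B) * height R \<le> height ([:- A, B:] * R)"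
proof (cases "R = 0")
  case True
  then show ?thesis
    by (simp add: height_def)
next
  case False
  obtain i where i: "height R = fls_abs (fls_of_poly_T (coeff R i))"
    using height_attained by blast
  let ?b = "fls_of_poly_T B * fls_of_poly_T (coeff R i)"
  let ?a = "- (fls_of_poly_T A * fls_of_poly_T (coeff R (Suc i)))"
  have pos: "height R > 0"
    using height_ge_1 [OF False] by simp
  have "fls_abs ?a \<le> fls_abs (fls_of_poly_T A) * height R"
    by (simp add: mult_left_mono abs_coeff_le_height)
  also have "\<dots> < fls_abs ?b"
    using assms pos by (simp add: i)
  finally have "fls_abs (?b + ?a) = fls_abs ?b"
    by (rule fls_abs_add_eq)
  moreover have "coeff ([:- A, B:] * R) (Suc i) = B * coeff R i + - (A * coeff R (Suc i))"
    by simp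
  ultimately have "fls_abs (fls_of_poly_T (coeff ([:- A, B:] * R) (Suc i))) = fls_abs ?b"
    by (simp only: fls_of_poly_T_add fls_of_poly_T_uminus fls_of_poly_T_mult)
  then show ?thesis
    using abs_coeff_le_height [of "[:- A, B:] * R" "Suc i"] i by simp
qed

lemma height_linear:
  assumes "fls_abs (fls_of_poly_T A) < fls_abs (fls_of_poly_T B)"
  shows "height [:- A, B:] = fls_abs (fls_of_poly_T B)"
proof -
  have "B \<noteq> 0"
    using assms by (metis fls_abs_0 fls_abs_nonneg fls_of_poly_T_0 not_less)
  then have "{..degree [:- A, B:]} = {0, 1}"
    by auto
  with assms show ?thesis
    by (simp add: height_def)
qed

text \<open>For v only the ordinary triangle inequality is at hand, so each Horner step costs a
  factor 3 = 1 + 2, the 2 being the bound on v x and v y.\<close>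

lemma extends_fls_abs_eval_diff_le:
  assumes "extends_fls_abs v" "v x \<le> 2" "v y \<le> 2" "degree P \<le> n"
    and "\<And>i. fls_abs (fls_of_poly_T (coeff P i)) \<le> H"
  shows "v (eval_ac P x - eval_ac P y) \<le> 3 ^ n * H * v (x - y)"
proof -
  have v: "v s \<ge> 0" "v 0 = 0" "v (s * t) = v s * v t" "v (s + t) \<le> v s + v t"
    "v (to_ac \<zeta>) = fls_abs \<zeta>" for s t \<zeta>
    using assms(1) by (auto simp: extends_fls_abs_def)
  have H0: "0 \<le> H"
    using assms(5) [of 0] fls_abs_nonneg order_trans by blast
  have eval: "v (eval_ac P x) \<le> 3 ^ n * H"
    if "degree P \<le> n" "\<And>i. fls_abs (fls_of_poly_T (coeff P i)) \<le> H" "v x \<le> 2" for P n x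
    using that(1,2)
  proof (induction n arbitrary: P)
    case 0
    then obtain A where "P = [:A:]"
      by (auto elim: degree_eq_zeroE)
    then show ?case
      using 0(2) [of 0] by (simp add: eval_ac_pCons v)
  next
    case (Suc n)
    obtain A R where P: "P = pCons A R"
      by (cases P)
    have "v (eval_ac R x) \<le> 3 ^ n * H"
      using Suc.prems(1) Suc.prems(2) [of "Suc i" for i]
      by (intro Suc.IH) (auto simp: P split: if_splits)
    then have "v (x * eval_ac R x) \<le> 2 * (3 ^ n * H)"
      unfolding v(3) using that(3) by (intro mult_mono v) auto
    moreover have "v (to_ac (fls_of_poly_T A)) \<le> H"
      using Suc.prems(2) [of 0] by (simp add: P v)
    moreover have "H \<le> 3 ^ n * H"
      using H0 by (simp add: mult_le_cancel_right1)
    ultimately show ?case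
      using v(4) [of "to_ac (fls_of_poly_T A)" "x * eval_ac R x"] by (simp add: P eval_ac_pCons)
  qed
  show "v (eval_ac P x - eval_ac P y) \<le> 3 ^ n * H * v (x - y)"
    using assms(4,5)
  proof (induction n arbitrary: P)
    case 0
    then obtain A where "P = [:A:]"
      by (auto elim: degree_eq_zeroE)
    then show ?case
      using H0 by (simp add: eval_ac_pCons v)
  next
    case (Suc n)
    obtain A R where P: "P = pCons A R"
      by (cases P)
    have R: "degree R \<le> n" "fls_abs (fls_of_poly_T (coeff R i)) \<le> H" for i
      using Suc.prems(1) Suc.prems(2) [of "Suc i"] by (auto simp: P split: if_splits)
    have "eval_ac P x - eval_ac P y =
        x * (eval_ac R x - eval_ac R y) + (x - y) * eval_ac R y"
      by (simp add: P eval_ac_pCons algebra_simps)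
    also have "v \<dots> \<le> v (x * (eval_ac R x - eval_ac R y)) + v ((x - y) * eval_ac R y)"
      by (rule v(4))
    also have "\<dots> \<le> 2 * (3 ^ n * H * v (x - y)) + v (x - y) * (3 ^ n * H)"
      unfolding v(3) using assms(2)
      by (intro add_mono mult_mono mult_left_mono v Suc.IH eval R assms(3)) auto
    finally have "v (eval_ac P x - eval_ac P y) \<le>
        2 * (3 ^ n * H * v (x - y)) + v (x - y) * (3 ^ n * H)" .
    then show ?case
      by (simp add: algebra_simps)
  qed
qed

text \<open>Multiplying by H^w' turns the hypothesis into H^(w' - w) \<le> C / c with a positive
  exponent. With finiteness for bounded heights, this excludes every exponent above w.\<close>

lemma bounded_of_powr_le:
  fixes c C H w w' :: real
  assumes "1 \<le> H" "0 < c" "w < w'" "c * H powr (- w) \<le> C * H powr (- w')"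
  shows "H \<le> (C / c) powr (1 / (w' - w))"
proof -
  have "H powr (w' - w) = H powr (- w) * H powr w'"
    by (simp flip: powr_add)
  also have "\<dots> \<le> (C / c * H powr (- w')) * H powr w'"
    using assms by (intro mult_right_mono) (auto simp: field_simps)
  also have "\<dots> = C / c"
    using assms by (simp add: powr_minus field_simps)
  finally have "(H powr (w' - w)) powr (1 / (w' - w)) \<le> (C / c) powr (1 / (w' - w))"
    using assms by (intro powr_mono2) auto
  then show ?thesis
    using assms by (simp add: powr_powr)
qed

section \<open>Exponents from a chain of good rational approximations\<close>

text \<open>The properties of a continued fraction that determine the exponents. Coprimality through
  \<open>bezout\<close> makes q k * X - p k primitive, \<open>num_less\<close> gives it height |q
  k|, and the two degree bounds tie |q (k+1)| to |q k|^w up to a factor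
  \<open>CARD('a)\<close>.\<close>

locale good_approximations =
  fixes \<xi> :: "'a :: {field, finite} fls" and w :: real and p q :: "nat \<Rightarrow> 'a poly"
  assumes w_ge_1: "w \<ge> 1"
    and abs_\<xi>: "fls_abs \<xi> \<le> 1"
    and den_0: "q 0 = 1"
    and den_monic: "lead_coeff (q k) = 1"
    and num_less: "fls_abs (fls_of_poly_T (p k)) < fls_abs (fls_of_poly_T (q k))"
    and bezout: "\<exists>a b. a * p k + b * q k = 1"
    and approx: "fls_abs (fls_of_poly_T (q k) * \<xi> - fls_of_poly_T (p k)) =
      1 / fls_abs (fls_of_poly_T (q (Suc k)))"
    and degree_less: "degree (q k) < degree (q (Suc k))"
    and degree_lower: "w * degree (q k) \<le> degree (q (Suc k))"
    and degree_upper: "degree (q (Suc k)) \<le> w * degree (q k) + 1"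
begin

abbreviation den_abs :: "nat \<Rightarrow> real" where
  "den_abs k \<equiv> fls_abs (fls_of_poly_T (q k))"

abbreviation convergent :: "nat \<Rightarrow> 'a fls" where
  "convergent k \<equiv> fls_of_poly_T (p k) / fls_of_poly_T (q k)"

abbreviation lin :: "nat \<Rightarrow> 'a poly poly" where
  "lin k \<equiv> [:- p k, q k:]"

lemma den_nonzero [simp]: "q k \<noteq> 0"
  using den_monic [of k] by auto

lemma den_abs_eq: "den_abs k = real CARD('a) powr degree (q k)"
  using CARD_field_gt_1 [where 'a = 'a] by (simp add: fls_abs_of_poly_T powr_realpow)

lemma den_abs_ge_1: "den_abs k \<ge> 1"
  by (simp add: fls_abs_of_poly_T_ge_1)

lemma den_abs_lower: "den_abs k powr w \<le> den_abs (Suc k)"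
  unfolding den_abs_eq powr_powr using degree_lower [of k] CARD_field_gt_1 [where 'a = 'a]
  by (intro powr_mono) (auto simp: mult.commute)

lemma den_abs_upper: "den_abs (Suc k) \<le> real CARD('a) * den_abs k powr w"
proof -
  have "den_abs (Suc k) \<le> real CARD('a) powr (1 + degree (q k) * w)"
    unfolding den_abs_eq using degree_upper [of k] CARD_field_gt_1 [where 'a = 'a]
    by (intro powr_mono) (auto simp: mult.commute)
  also have "\<dots> = real CARD('a) * den_abs k powr w"
    unfolding den_abs_eq powr_powr powr_add by simp
  finally show ?thesis .
qed

lemma strict_mono_degree: "strict_mono (\<lambda>k. degree (q k))"
  by (simp add: strict_mono_Suc_iff degree_less)

lemma den_abs_unbounded: "\<exists>k. B < den_abs k"
proof -
  obtain k where "B < real CARD('a) ^ k"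
    using real_arch_pow [of "real CARD('a)" B] CARD_field_gt_1 [where 'a = 'a] by auto
  also have "\<dots> \<le> den_abs k"
    using CARD_field_gt_1 [where 'a = 'a] strict_mono_imp_increasing [OF strict_mono_degree, of k]
    by (simp add: fls_abs_of_poly_T power_increasing)
  finally show ?thesis ..
qed

lemma abs_convergent: "fls_abs (convergent k) \<le> 1"
  using num_less [of k] den_abs_ge_1 [of k] by simp

lemma abs_diff_convergent: "fls_abs (\<xi> - convergent k) = 1 / (den_abs k * den_abs (Suc k))"
proof -
  have "\<xi> - convergent k = (fls_of_poly_T (q k) * \<xi> - fls_of_poly_T (p k)) / fls_of_poly_T (q k)"
    by (simp add: diff_divide_distrib)
  then show ?thesis
    by (simp only: fls_abs_divide approx) simp
qed

lemma abs_diff_convergent_le: "fls_abs (\<xi> - convergent k) \<le> den_abs k powr (- w - 1)"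
proof -
  have "1 / (den_abs k * den_abs (Suc k)) \<le> 1 / (den_abs k * den_abs k powr w)"
    using den_abs_lower [of k] den_abs_ge_1 [of k] by (intro divide_left_mono mult_left_mono) auto
  also have "\<dots> = den_abs k powr (- w - 1)"
    using den_abs_ge_1 [of k] by (simp add: powr_diff powr_minus field_simps)
  finally show ?thesis
    by (simp add: abs_diff_convergent)
qed

lemma eval_lin: "eval_fls (lin k) x = fls_of_poly_T (q k) * x - fls_of_poly_T (p k)"
  by (simp add: eval_fls_pCons)

lemma eval_lin_convergent: "eval_ac (lin k) (to_ac (convergent k)) = 0"
  unfolding eval_ac_to_ac eval_lin by simp

lemma height_lin: "height (lin k) = den_abs k"
  using num_less by (rule height_linear)

lemma primitive_lin: "primitive_poly (lin k)"
  unfolding primitive_poly_def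
proof (intro allI impI)
  fix c assume c: "\<forall>i. c dvd coeff (lin k) i"
  have "c dvd p k" "c dvd q k"
    using spec [OF c, of 0] spec [OF c, of 1] by simp_all
  moreover obtain a b where "a * p k + b * q k = 1"
    using bezout by blast
  ultimately show "c dvd 1"
    by (metis dvd_add dvd_mult)
qed

lemma degree_lin_le: "S \<noteq> 0 \<Longrightarrow> eval_ac S \<alpha> = 0 \<Longrightarrow> degree (lin k) \<le> degree S"
  using degree_pos_of_eval_ac_eq_0 [of S \<alpha>] by simp

lemma lin_eqD: "lin j = lin k \<Longrightarrow> j = k"
  using strict_mono_eq [OF strict_mono_degree, of j k] by simp

text \<open>Since \<open>lin k\<close> is primitive and of minimal degree at the convergent, the
  division takes place over polynomials in T, with no denominators.\<close>

lemma lin_dvd: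
  assumes "eval_fls P (convergent k) = 0"
  shows "lin k dvd P"
proof (rule primitive_dvd_of_minimal_degree [OF primitive_lin _ eval_lin_convergent])
  show "eval_ac P (to_ac (convergent k)) = 0"
    unfolding eval_ac_to_ac by (simp add: assms)
qed (simp, rule degree_lin_le)

lemma defining_poly_convergent: "defining_poly (to_ac (convergent k)) = lin k"
  by (rule defining_poly_eqI(2) [OF primitive_lin _ eval_lin_convergent])
    (use den_monic degree_lin_le in auto)

text \<open>The constant serves both cases: raising \<open>den_abs_upper\<close> to the power n
  produces \<open>CARD('a)\<close> to the power n, and splitting off a linear factor costs one
  factor \<open>CARD('a)\<close> while lowering n by one.\<close>

lemma abs_eval_ge:
  assumes "2 * real n - 1 \<le> w" "degree P \<le> n" "P \<noteq> 0"
  shows "real CARD('a) powr (- real n) * height P powr (- w) \<le> fls_abs (eval_fls P \<xi>)"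
  using assms
proof (induction n arbitrary: P rule: less_induct)
  case (less n)
  let ?Q = "real CARD('a)" and ?H = "height P" and ?e = "w + 1 - real n"
  have Q: "?Q > 1"
    using CARD_field_gt_1 [where 'a = 'a] by simp
  have H: "?H \<ge> 1"
    using less.prems by (intro height_ge_1) simp
  \<comment> \<open>The hypothesis 2 n - 1 \<le> w says exactly that n \<le> w + 1 - n.\<close>
  have e: "?e \<ge> 1" "?e \<ge> real n"
    using less.prems(1) w_ge_1 by linarith+
  define k where "k = (LEAST k. ?H < den_abs k powr ?e)"
  have "\<exists>k. ?H < den_abs k powr ?e"
  proof -
    obtain k where "?H < den_abs k"
      using den_abs_unbounded by blast
    also have "den_abs k \<le> den_abs k powr ?e"
      using powr_mono [OF e(1) den_abs_ge_1 [of k]] den_abs_ge_1 [of k] by simp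
    finally show ?thesis ..
  qed
  then have k: "?H < den_abs k powr ?e"
    unfolding k_def by (rule LeastI_ex)
  show ?case
  proof (cases "eval_fls P (convergent k) = 0")
    case False
    \<comment> \<open>At index 0 the denominator is 1, so the defining inequality of k would give a
      height below 1.\<close>
    have "k \<noteq> 0"
      using k H den_0 by (intro notI) simp
    then obtain j where j: "k = Suc j"
      by (cases k) auto
    then have j_less: "\<not> ?H < den_abs j powr ?e"
      unfolding k_def using not_less_Least by (metis lessI)
    have "den_abs k powr real n \<le> (?Q * den_abs j powr w) powr real n"
      unfolding j using den_abs_upper [of j] by (intro powr_mono2) auto
    also have "\<dots> = ?Q powr real n * (den_abs j powr real n) powr w"
      by (simp add: powr_mult powr_powr mult.commute)
    also have "\<dots> \<le> ?Q powr real n * ?H powr w"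
    proof -
      have "den_abs j powr real n \<le> den_abs j powr ?e"
        using e(2) den_abs_ge_1 by (rule powr_mono)
      with j_less have "den_abs j powr real n \<le> ?H"
        by simp
      then show ?thesis
        using w_ge_1 by (intro mult_left_mono powr_mono2) auto
    qed
    finally have *: "den_abs k powr real n \<le> ?Q powr real n * ?H powr w" .
    have "fls_abs (eval_fls P \<xi> - eval_fls P (convergent k)) \<le> ?H * fls_abs (\<xi> - convergent k)"
      using abs_\<xi> abs_convergent abs_coeff_le_height by (rule fls_abs_eval_diff_le)
    also have "\<dots> \<le> ?H * den_abs k powr (- w - 1)"
      using H abs_diff_convergent_le by (intro mult_left_mono) auto
    \<comment> \<open>The exponent \<open>?e\<close> is chosen so that this product is |q k|^(-n),
      the Liouville bound at the convergent.\<close>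
    also have "\<dots> < den_abs k powr ?e * den_abs k powr (- w - 1)"
      using k den_abs_ge_1 [of k] by (intro mult_strict_right_mono) auto
    also have "\<dots> = den_abs k powr (- real n)"
      by (simp flip: powr_add)
    finally have diff: "fls_abs (eval_fls P \<xi> - eval_fls P (convergent k)) < den_abs k powr (- real n)" .
    have ge: "den_abs k powr (- real n) \<le> fls_abs (eval_fls P (convergent k))"
      using abs_eval_fraction_ge [OF den_nonzero less.prems(2) False] den_abs_ge_1 [of k]
      by (simp add: powr_minus powr_realpow divide_inverse del: fls_abs_divide)
    have "fls_abs (eval_fls P (convergent k) + (eval_fls P \<xi> - eval_fls P (convergent k))) =
        fls_abs (eval_fls P (convergent k))"
      using diff ge by (intro fls_abs_add_eq) simp
    then have "den_abs k powr (- real n) \<le> fls_abs (eval_fls P \<xi>)"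
      using ge by simp
    moreover have "?Q powr (- real n) * ?H powr (- w) \<le> den_abs k powr (- real n)"
      using * Q H den_abs_ge_1 [of k] by (simp add: powr_minus field_simps)
    ultimately show ?thesis
      by simp
  next
    case True
    then obtain R where R: "P = lin k * R"
      using lin_dvd by blast
    have nz: "R \<noteq> 0"
      using R less.prems(3) by auto
    have "degree P = Suc (degree R)"
      unfolding R using nz by (subst degree_mult_eq) auto
    with less.prems(2) obtain m where n: "n = Suc m"
      by (cases n) auto
    have m: "m < n" "degree R \<le> m"
      using n less.prems(2) \<open>degree P = _\<close> by auto
    have IH: "?Q powr (- real m) * height R powr (- w) \<le> fls_abs (eval_fls R \<xi>)"
      using less.IH [OF m(1) _ m(2) nz] less.prems(1) n by simp
    have HR: "height R \<ge> 1"
      using nz by (rule height_ge_1)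
    have "?H powr (- w) \<le> (den_abs k * height R) powr (- w)"
      using height_linear_mult_ge [OF num_less [of k], of R] HR den_abs_ge_1 [of k] w_ge_1
      by (intro powr_mono2') (auto simp: R)
    then have "?Q powr (- real n) * ?H powr (- w) \<le>
        ?Q powr (- real n) * (den_abs k * height R) powr (- w)"
      by (intro mult_left_mono) auto
    also have "\<dots> = 1 / (?Q * den_abs k powr w) * (?Q powr (- real m) * height R powr (- w))"
    proof -
      have "?Q powr (- real n) = ?Q powr (- real m) / ?Q"
        using Q by (simp add: n powr_diff powr_minus field_simps)
      moreover have "(den_abs k * height R) powr (- w) = height R powr (- w) / den_abs k powr w"
        using HR by (simp add: powr_mult powr_minus field_simps)
      ultimately show ?thesis
        by simp
    qed
    \<comment> \<open>The factor 1 / |q (k+1)| is the exact absolute value of \<open>lin k\<close>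
      at \<xi>, by \<open>approx\<close>.\<close>
    also have "\<dots> \<le> 1 / den_abs (Suc k) * fls_abs (eval_fls R \<xi>)"
      using den_abs_upper [of k] den_abs_ge_1 [of "Suc k"] den_abs_ge_1 [of k] Q
      by (intro mult_mono IH divide_left_mono) auto
    also have "\<dots> = fls_abs (eval_fls P \<xi>)"
      by (simp add: R eval_lin approx del: mult_pCons_left)
    finally show ?thesis .
  qed
qed

text \<open>The lower bound is positive; this supplies the condition 0 < |P(\<xi>)| in
  \<open>w_exp\<close>.\<close>

lemma eval_\<xi>_nonzero:
  assumes "2 * real n - 1 \<le> w" "degree P \<le> n" "P \<noteq> 0"
  shows "eval_fls P \<xi> \<noteq> 0"
proof -
  have "0 < real CARD('a) powr (- real n) * height P powr (- w)"
    using height_ge_1 [OF assms(3)] CARD_field_gt_1 [where 'a = 'a] by simp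
  then show ?thesis
    using abs_eval_ge [OF assms] by auto
qed

lemma w_exp_eq:
  assumes "1 \<le> n" "2 * real n - 1 \<le> w"
  shows "w_exp n \<xi> = ereal w"
proof (rule antisym)
  let ?X = "\<lambda>u. {P :: 'a poly poly. degree P \<le> n \<and>
       0 < fls_abs (eval_fls P \<xi>) \<and> fls_abs (eval_fls P \<xi>) \<le> height P powr (- u)}"
  show "w_exp n \<xi> \<le> ereal w"
    unfolding w_exp_def
  proof (rule Sup_least, safe)
    fix u assume inf: "infinite (?X u)"
    have "finite (?X u)" if "w < u"
    proof (rule finite_subset [OF _ finite_bounded_height])
      show "?X u \<subseteq> {P. degree P \<le> n \<and>
          height P \<le> (1 / real CARD('a) powr (- real n)) powr (1 / (u - w))}"
      proof safe
        fix P assume P: "degree P \<le> n" "0 < fls_abs (eval_fls P \<xi>)"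
          "fls_abs (eval_fls P \<xi>) \<le> height P powr (- u)"
        then have "P \<noteq> 0"
          by auto
        then show "height P \<le> (1 / real CARD('a) powr (- real n)) powr (1 / (u - w))"
          using abs_eval_ge [OF assms(2) P(1)] P(3) CARD_field_gt_1 [where 'a = 'a] that
          by (intro bounded_of_powr_le) (auto simp: height_ge_1)
      qed
    qed
    with inf show "ereal u \<le> ereal w"
      by force
  qed
  \<comment> \<open>The linear polynomials \<open>lin k\<close> already realise the exponent w
    itself, so the supremum is attained.\<close>
  have "range lin \<subseteq> ?X w"
  proof safe
    fix k
    show "degree (lin k) \<le> n"
      using assms(1) by simp
    then show "0 < fls_abs (eval_fls (lin k) \<xi>)"
      using eval_\<xi>_nonzero [OF assms(2)] by simp
    show "fls_abs (eval_fls (lin k) \<xi>) \<le> height (lin k) powr (- w)"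
      unfolding eval_lin approx height_lin
      using den_abs_lower [of k] den_abs_ge_1 [of k] den_abs_ge_1 [of "Suc k"]
      by (simp add: powr_minus field_simps)
  qed
  moreover have "inj lin"
    using lin_eqD by (rule injI)
  ultimately have "infinite (?X w)"
    using finite_imageD finite_subset infinite_UNIV_nat by blast
  then show "ereal w \<le> w_exp n \<xi>"
    unfolding w_exp_def by (intro Sup_upper) blast
qed

lemma w_star_exp_eq:
  assumes "extends_fls_abs v" "1 \<le> n" "2 * real n - 1 \<le> w"
  shows "w_star_exp v n \<xi> = ereal w"
proof (rule antisym)
  let ?X = "\<lambda>u. {\<alpha> \<in> FqT_closure. alg_degree \<alpha> \<le> n \<and>
       0 < v (to_ac \<xi> - \<alpha>) \<and> v (to_ac \<xi> - \<alpha>) \<le> alg_height \<alpha> powr (- u - 1)}"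
  let ?c = "real CARD('a) powr (- real n)"
  have v: "v (s + t) \<le> v s + v t" "v (s * t) = v s * v t" "v (to_ac \<zeta>) = fls_abs \<zeta>" for s t \<zeta>
    using assms(1) by (auto simp: extends_fls_abs_def)
  show "w_star_exp v n \<xi> \<le> ereal w"
    unfolding w_star_exp_def
  proof (rule Sup_least, safe)
    fix u assume inf: "infinite (?X u)"
    have "finite (?X u)" if u: "w < u"
    proof -
      let ?B = "(3 ^ n / ?c) powr (1 / (u - w))"
      \<comment> \<open>Each \<alpha> is a root of its defining polynomial, whose height will be
        bounded. The zero polynomial is removed because everything is a root of it.\<close>
      have "?X u \<subseteq> (\<Union>P \<in> {P. degree P \<le> n \<and> height P \<le> ?B} - {0}. {\<alpha>. eval_ac P \<alpha> = 0})"
      proof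
        fix \<alpha> assume \<alpha>: "\<alpha> \<in> ?X u"
        define P where "P = defining_poly \<alpha>"
        have "is_defining_poly P \<alpha>"
          unfolding P_def using \<alpha> by (simp add: is_defining_poly_defining_poly)
        then have P: "P \<noteq> 0" "eval_ac P \<alpha> = 0"
          by (auto simp: is_defining_poly_def)
        have deg: "degree P \<le> n" and le: "v (to_ac \<xi> - \<alpha>) \<le> height P powr (- u - 1)"
          using \<alpha> by (auto simp: alg_degree_def alg_height_def P_def)
        have H: "height P \<ge> 1"
          using P(1) by (rule height_ge_1)
        have "height P powr (- u - 1) \<le> height P powr 0"
          using H u w_ge_1 by (intro powr_mono) auto
        then have "v (to_ac \<xi> - \<alpha>) \<le> 1"
          using le H by simp
        \<comment> \<open>Invariance of v under negation is not among the axioms of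
          \<open>extends_fls_abs\<close>; it follows from multiplicativity and the value at
          -1.\<close>
        moreover have "v (- 1) = 1"
          using v(3) [of "- 1"] by simp
        then have "v (- (to_ac \<xi> - \<alpha>)) = v (to_ac \<xi> - \<alpha>)"
          using v(2) [of "- 1" "to_ac \<xi> - \<alpha>"] by simp
        ultimately have v\<alpha>: "v \<alpha> \<le> 2"
          using v(1) [of "to_ac \<xi>" "- (to_ac \<xi> - \<alpha>)"] abs_\<xi> by (simp add: v(3))
        have "?c * height P powr (- w) \<le> fls_abs (eval_fls P \<xi>)"
          using assms(3) deg P(1) by (rule abs_eval_ge)
        also have "\<dots> = v (eval_ac P (to_ac \<xi>) - eval_ac P \<alpha>)"
          by (simp add: P(2) eval_ac_to_ac v(3))
        also have "\<dots> \<le> 3 ^ n * height P * v (to_ac \<xi> - \<alpha>)"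
          using abs_\<xi> v\<alpha> deg abs_coeff_le_height
          by (intro extends_fls_abs_eval_diff_le assms(1)) (auto simp: v(3))
        also have "\<dots> \<le> 3 ^ n * height P * height P powr (- u - 1)"
          using le H by (intro mult_left_mono) auto
        also have "\<dots> = 3 ^ n * height P powr (- u)"
          using H by (simp add: powr_diff)
        finally have "height P \<le> ?B"
          using H u CARD_field_gt_1 [where 'a = 'a] by (intro bounded_of_powr_le) auto
        then show "\<alpha> \<in> (\<Union>P \<in> {P. degree P \<le> n \<and> height P \<le> ?B} - {0}. {\<alpha>. eval_ac P \<alpha> = 0})"
          using P deg by blast
      qed
      then show ?thesis
        by (rule finite_subset)
          (intro finite_UN_I finite_Diff finite_bounded_height finite_roots_eval_ac, simp)
    qed
    with inf show "ereal u \<le> ereal w"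
      by force
  qed
  have "range (\<lambda>k. to_ac (convergent k)) \<subseteq> ?X w"
  proof safe
    fix k
    show "to_ac (convergent k) \<in> FqT_closure"
      unfolding FqT_closure_def using eval_lin_convergent [of k] by (auto intro!: exI [of _ "lin k"])
    show "alg_degree (to_ac (convergent k)) \<le> n"
      unfolding alg_degree_def defining_poly_convergent using assms(2) by simp
    have diff: "to_ac \<xi> - to_ac (convergent k) = to_ac (\<xi> - convergent k)"
      by simp
    have "fls_abs (\<xi> - convergent k) > 0"
      unfolding abs_diff_convergent using den_abs_ge_1 [of k] den_abs_ge_1 [of "Suc k"] by simp
    then show "0 < v (to_ac \<xi> - to_ac (convergent k))"
      unfolding diff v(3) .
    show "v (to_ac \<xi> - to_ac (convergent k)) \<le> alg_height (to_ac (convergent k)) powr (- w - 1)"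
      unfolding diff v(3) alg_height_def defining_poly_convergent height_lin
      by (rule abs_diff_convergent_le)
  qed
  \<comment> \<open>Equal convergents have equal defining polynomials, and the degrees of the
    denominators tell these apart.\<close>
  moreover have "inj (\<lambda>k. to_ac (convergent k))"
  proof (rule injI)
    fix j k assume "to_ac (convergent j) = to_ac (convergent k)"
    then show "j = k"
      by (intro lin_eqD) (metis defining_poly_convergent)
  qed
  ultimately have "infinite (?X w)"
    using finite_imageD finite_subset infinite_UNIV_nat by blast
  then show "ereal w \<le> w_star_exp v n \<xi>"
    unfolding w_star_exp_def by (intro Sup_upper) blast
qed

end

section \<open>Completeness of the field of Laurent series\<close>

lemma fls_nth_eq_0_of_abs_less:
  fixes z :: "'a :: {field, finite} fls"
  assumes "fls_abs z < real CARD('a) powr (- real_of_int n)"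
  shows "fls_nth z n = 0"
proof (cases "z = 0")
  case False
  then have "n < fls_subdegree z"
    using assms CARD_field_gt_1 [where 'a = 'a] by (simp add: fls_abs_def)
  then show ?thesis
    by simp
qed simp

lemma fls_abs_le_of_nth_eq_0:
  fixes z :: "'a :: {field, finite} fls"
  assumes "\<And>n. n < m \<Longrightarrow> fls_nth z n = 0"
  shows "fls_abs z \<le> real CARD('a) powr (- real_of_int m)"
proof (cases "z = 0")
  case False
  then have "m \<le> fls_subdegree z"
    using assms by (rule fls_subdegree_geI)
  with False show ?thesis
    using CARD_field_gt_1 [where 'a = 'a] by (simp add: fls_abs_def)
qed simp

text \<open>Because the steps shrink strictly, the ultrametric inequality gives x m - x k absolute
  value exactly r k for all m > k, and this equality survives in the limit. The bound
  \<open>small\<close> makes the coefficient of index k stable from x k onwards.\<close>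

lemma fls_sequence_limit:
  fixes x :: "nat \<Rightarrow> 'a :: {field, finite} fls" and r :: "nat \<Rightarrow> real"
  assumes bounded: "\<And>k. fls_abs (x k) \<le> 1"
    and step: "\<And>k. fls_abs (x (Suc k) - x k) = r k"
    and decreasing: "\<And>k. r (Suc k) < r k"
    and small: "\<And>k. r k < real CARD('a) powr (- real k)"
  shows "\<exists>y. \<forall>k. fls_abs (y - x k) = r k"
proof -
  have Q: "real CARD('a) > 1"
    using CARD_field_gt_1 [where 'a = 'a] by simp
  have r_mono: "r m < r k" if "k < m" for k m
    using lift_Suc_mono_less [of "\<lambda>k. - r k"] decreasing that by fastforce
  have r_pos: "0 < r k" for k
    using decreasing [of k] step [of "Suc k"] fls_abs_nonneg [of "x (Suc (Suc k)) - x (Suc k)"]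
    by linarith
  have dist: "fls_abs (x m - x k) = r k" if "k < m" for k m
    using that
  proof (induction m)
    case (Suc m)
    show ?case
    proof (cases "k = m")
      case True
      then show ?thesis
        by (simp add: step)
    next
      case False
      with Suc have "k < m" "fls_abs (x m - x k) = r k"
        by auto
      then have "fls_abs ((x m - x k) + (x (Suc m) - x m)) = r k"
        using r_mono step by (subst fls_abs_add_eq) auto
      then show ?thesis
        by simp
    qed
  qed simp
  \<comment> \<open>A diagonal choice of stable coefficients. A power series suffices because |x k|
    \<le> 1 leaves no coefficients of negative index.\<close>
  define y where "y = fps_to_fls (Abs_fps (\<lambda>n. fls_nth (x n) (int n)))"
  have close: "fls_abs (y - x m) \<le> real CARD('a) powr (- real m)" for m
  proof -
    have "fls_nth (y - x m) n = 0" if "n < int m" for n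
    proof (cases "n < 0")
      case True
      then have "fls_abs (x m) < real CARD('a) powr (- real_of_int n)"
        using Q by (intro le_less_trans [OF bounded] gr_one_powr) auto
      with True show ?thesis
        by (simp add: y_def fls_nth_eq_0_of_abs_less)
    next
      case False
      then obtain i where i: "n = int i"
        by (metis nonneg_int_cases not_less)
      then have "fls_abs (x m - x i) < real CARD('a) powr (- real_of_int n)"
        using dist [of i m] small [of i] that by simp
      then have "fls_nth (x m - x i) n = 0"
        by (rule fls_nth_eq_0_of_abs_less)
      then show ?thesis
        by (simp add: y_def i)
    qed
    then show ?thesis
      using fls_abs_le_of_nth_eq_0 [of "int m" "y - x m"] by simp
  qed
  have "fls_abs (y - x k) = r k" for k
  proof -
    obtain i where i: "inverse (r k) < real CARD('a) ^ i"
      using real_arch_pow [OF Q] by blast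
    \<comment> \<open>Beyond k, so that x m has distance r k from x k, and beyond i, so that y is
      closer to x m than r k.\<close>
    define m where "m = Suc (max i k)"
    have "real CARD('a) ^ i \<le> real CARD('a) ^ m"
      using Q by (intro power_increasing) (auto simp: m_def)
    with i have "inverse (r k) < real CARD('a) ^ m"
      by simp
    then have "real CARD('a) powr (- real m) < r k"
      using r_pos [of k] Q by (simp add: powr_minus powr_realpow field_simps)
    then have "fls_abs (y - x m) < r k"
      using close [of m] by simp
    moreover have "fls_abs (x m - x k) = r k"
      by (rule dist) (simp add: m_def)
    ultimately have "fls_abs ((x m - x k) + (y - x m)) = r k"
      by (subst fls_abs_add_eq) auto
    then show ?thesis
      by simp
  qed
  then show ?thesis
    by blast
qed

section \<open>Continued fractions\<close>

text \<open>The convergents of \<open>[0; a 0, a 1, \<dots>]\<close>; the denominator of index \<open>k\<close> involves \<open>a i\<close>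
  for \<open>i < k\<close> only.\<close>

fun cf_num :: "(nat \<Rightarrow> 'a :: comm_ring_1) \<Rightarrow> nat \<Rightarrow> 'a" where
  "cf_num a 0 = 0"
| "cf_num a (Suc 0) = 1"
| "cf_num a (Suc (Suc k)) = a (Suc k) * cf_num a (Suc k) + cf_num a k"

fun cf_den :: "(nat \<Rightarrow> 'a :: comm_ring_1) \<Rightarrow> nat \<Rightarrow> 'a" where
  "cf_den a 0 = 1"
| "cf_den a (Suc 0) = a 0"
| "cf_den a (Suc (Suc k)) = a (Suc k) * cf_den a (Suc k) + cf_den a k"

lemma cf_determinant:
  "cf_num a (Suc k) * cf_den a k - cf_num a k * cf_den a (Suc k) = (- 1) ^ k"
proof (induction k)
  case (Suc k)
  have "cf_num a (Suc (Suc k)) * cf_den a (Suc k) - cf_num a (Suc k) * cf_den a (Suc (Suc k)) =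
      - (cf_num a (Suc k) * cf_den a k - cf_num a k * cf_den a (Suc k))"
    by (simp add: algebra_simps)
  then show ?case
    by (simp only: Suc.IH) simp
qed simp

lemma cf_cong:
  assumes "\<And>i. i < k \<Longrightarrow> a i = b i"
  shows "cf_num a k = cf_num b k" "cf_den a k = cf_den b k"
  using assms by (induction k rule: induct_nat_012) auto

text \<open>With common convergents up to index k, the two expansions at k + 1 differ only through a
  k and b k, so the expression reduces to the usual determinant times their difference.\<close>

lemma cf_cross_determinant:
  assumes "\<And>i. i < k \<Longrightarrow> a i = b i"
  shows "cf_num a (Suc k) * cf_den b (Suc k) - cf_num b (Suc k) * cf_den a (Suc k) =
    (- 1) ^ k * (b k - a k)"
proof (cases k)
  case (Suc j)
  have eq: "cf_num b (Suc j) = cf_num a (Suc j)" "cf_den b (Suc j) = cf_den a (Suc j)"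
    "cf_num b j = cf_num a j" "cf_den b j = cf_den a j"
    using assms cf_cong [of "Suc j" a b] cf_cong [of j a b] by (auto simp: Suc)
  have "cf_num a (Suc k) * cf_den b (Suc k) - cf_num b (Suc k) * cf_den a (Suc k) =
      - (b k - a k) * (cf_num a (Suc j) * cf_den a j - cf_num a j * cf_den a (Suc j))"
    by (simp add: Suc eq algebra_simps)
  then show ?thesis
    unfolding cf_determinant by (simp add: Suc algebra_simps)
qed simp

text \<open>Leading coefficient and degree go into one induction because the degrees decide which
  summand of the recursion leads.\<close>

lemma cf_den_monic:
  fixes a :: "nat \<Rightarrow> 'a :: field poly"
  assumes "\<And>i. lead_coeff (a i) = 1" "\<And>i. degree (a i) > 0"
  shows "lead_coeff (cf_den a k) = 1 \<and> degree (cf_den a k) = (\<Sum>i<k. degree (a i))"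
proof (induction k rule: induct_nat_012)
  case (ge2 k)
  have nz: "cf_den a (Suc k) \<noteq> 0" "a (Suc k) \<noteq> 0"
    using ge2(2) assms(2) [of "Suc k"] by auto
  let ?m = "a (Suc k) * cf_den a (Suc k)"
  have deg: "degree ?m = (\<Sum>i<Suc (Suc k). degree (a i))"
    using nz ge2(2) by (simp add: degree_mult_eq)
  have less: "degree (cf_den a k) < degree ?m"
    using ge2(1) deg assms(2) [of k] by simp
  have "lead_coeff (cf_den a (Suc (Suc k))) = lead_coeff ?m"
    using lead_coeff_add_le [OF less] by (simp only: cf_den.simps add.commute)
  also have "\<dots> = 1"
    using ge2(2) [THEN conjunct1] by (simp only: lead_coeff_mult assms(1) mult_1_left)
  finally show ?case
    using degree_add_eq_left [OF less] deg by simp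
qed (use assms in auto)

text \<open>In the recursion for the denominators the product term strictly dominates, so it carries
  the whole absolute value; both terms of the numerator are smaller than it.\<close>

lemma cf_num_less_den:
  fixes a :: "nat \<Rightarrow> 'a :: {field, finite} poly"
  assumes "\<And>i. lead_coeff (a i) = 1" "\<And>i. degree (a i) > 0"
  shows "fls_abs (fls_of_poly_T (cf_num a k)) < fls_abs (fls_of_poly_T (cf_den a k))"
proof (induction k rule: induct_nat_012)
  case 1
  have "a 0 \<noteq> 0"
    using assms(2) [of 0] by auto
  then show ?case
    using assms(2) [of 0] CARD_field_gt_1 [where 'a = 'a] by (simp add: fls_abs_of_poly_T)
next
  case (ge2 k)
  have den_nz: "cf_den a j \<noteq> 0" for j
    using cf_den_monic [of a j] assms by auto
  have a_nz: "a i \<noteq> 0" for i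
    using assms(2) [of i] by auto
  let ?m = "fls_of_poly_T (a (Suc k)) * fls_of_poly_T (cf_den a (Suc k))"
  have less: "fls_abs (fls_of_poly_T (cf_den a k)) < fls_abs ?m"
  proof -
    have "degree (cf_den a k) < degree (a (Suc k) * cf_den a (Suc k))"
      using cf_den_monic [of a k] cf_den_monic [of a "Suc k"] assms assms(2) [of k] a_nz den_nz
      by (simp add: degree_mult_eq)
    then have "fls_abs (fls_of_poly_T (cf_den a k)) <
        fls_abs (fls_of_poly_T (a (Suc k) * cf_den a (Suc k)))"
      using a_nz den_nz CARD_field_gt_1 [where 'a = 'a]
      by (subst (1 2) fls_abs_of_poly_T) auto
    then show ?thesis
      by simp
  qed
  have "fls_abs (fls_of_poly_T (cf_num a (Suc (Suc k)))) \<le>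
      max (fls_abs (fls_of_poly_T (a (Suc k)) * fls_of_poly_T (cf_num a (Suc k))))
        (fls_abs (fls_of_poly_T (cf_num a k)))"
    by (simp only: cf_num.simps fls_of_poly_T_add fls_of_poly_T_mult fls_abs_add_le)
  also have "\<dots> < fls_abs ?m"
    using ge2 less a_nz by (auto intro: less_trans)
  also have "fls_abs ?m = fls_abs (?m + fls_of_poly_T (cf_den a k))"
    using less by (rule fls_abs_add_eq [symmetric])
  finally show ?case
    by simp
qed simp

text \<open>The determinant \<plusminus>1 makes consecutive convergents differ by exactly 1 / |q_k
  q_(k+1)|. Completeness transfers this distance to the limit, and multiplying by q_k gives the
  claim.\<close>

lemma cf_limit:
  fixes a :: "nat \<Rightarrow> 'a :: {field, finite} poly"
  assumes "\<And>i. lead_coeff (a i) = 1" "\<And>i. degree (a i) > 0"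
  shows "\<exists>\<xi>. fls_abs \<xi> \<le> 1 \<and>
    (\<forall>k. fls_abs (fls_of_poly_T (cf_den a k) * \<xi> - fls_of_poly_T (cf_num a k)) =
      1 / fls_abs (fls_of_poly_T (cf_den a (Suc k))))"
proof -
  let ?Q = "real CARD('a)"
  let ?p = "\<lambda>k. fls_of_poly_T (cf_num a k)" and ?q = "\<lambda>k. fls_of_poly_T (cf_den a k)"
  define r where "r k = 1 / (fls_abs (?q k) * fls_abs (?q (Suc k)))" for k
  have Q: "?Q > 1"
    using CARD_field_gt_1 [where 'a = 'a] by simp
  have nz: "cf_den a k \<noteq> 0" for k
    using cf_den_monic [of a k] assms by auto
  have abs_q: "fls_abs (?q k) = ?Q ^ (\<Sum>i<k. degree (a i))" for k
    using nz cf_den_monic [of a k] assms by (simp add: fls_abs_of_poly_T)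
  have step: "fls_abs (?p (Suc k) / ?q (Suc k) - ?p k / ?q k) = r k" for k
  proof -
    have "?p (Suc k) / ?q (Suc k) - ?p k / ?q k =
        fls_of_poly_T (cf_num a (Suc k) * cf_den a k - cf_num a k * cf_den a (Suc k)) /
        (?q k * ?q (Suc k))"
      using nz by (simp add: diff_frac_eq mult.commute)
    then show ?thesis
      unfolding cf_determinant by (simp add: r_def)
  qed
  have decreasing: "r (Suc k) < r k" for k
    unfolding r_def abs_q power_add [symmetric] using Q assms(2) [of k] assms(2) [of "Suc k"]
    by (intro divide_strict_left_mono power_strict_increasing) auto
  have sum_ge: "k \<le> (\<Sum>i<k. degree (a i))" for k
    using sum_mono [of "{..<k}" "\<lambda>_. 1" "\<lambda>i. degree (a i)"] assms(2) by (simp add: Suc_le_eq)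
  have small: "r k < ?Q powr (- real k)" for k
  proof -
    have "?Q ^ k < ?Q ^ ((\<Sum>i<k. degree (a i)) + (\<Sum>i<Suc k. degree (a i)))"
      using Q sum_ge [of k] assms(2) [of k] by (intro power_strict_increasing) auto
    then show ?thesis
      unfolding r_def abs_q power_add [symmetric] using Q
      by (simp add: powr_minus powr_realpow field_simps)
  qed
  have bounded: "fls_abs (?p k / ?q k) \<le> 1" for k
    using cf_num_less_den [of a k] assms nz by (simp add: divide_le_eq)
  obtain \<xi> where \<xi>: "\<And>k. fls_abs (\<xi> - ?p k / ?q k) = r k"
    using fls_sequence_limit [of "\<lambda>k. ?p k / ?q k" r] bounded step decreasing small by blast
  have "fls_abs \<xi> \<le> 1"
    using \<xi> [of 0] small [of 0] Q by simp
  moreover have "fls_abs (?q k * \<xi> - ?p k) = 1 / fls_abs (?q (Suc k))" for k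
  proof -
    have "?q k * \<xi> - ?p k = ?q k * (\<xi> - ?p k / ?q k)"
      using nz by (simp add: right_diff_distrib)
    then show ?thesis
      using nz by (simp only: fls_abs_mult \<xi> r_def) simp
  qed
  ultimately show ?thesis
    by blast
qed

section \<open>Prescribed degrees and binary choices of partial quotients\<close>

primrec den_degree :: "real \<Rightarrow> nat \<Rightarrow> nat" where
  "den_degree w 0 = 0"
| "den_degree w (Suc k) = Suc (nat \<lfloor>w * den_degree w k\<rfloor>)"

text \<open>The successor in the recursion makes the growth strict: starting from 0, the floor alone
  would stay at 0.\<close>

lemma den_degree_less:
  assumes "w \<ge> 1"
  shows "den_degree w k < den_degree w (Suc k)"
proof -
  have "real (den_degree w k) \<le> w * den_degree w k"
    using assms by (simp add: mult_le_cancel_right1)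
  then have "int (den_degree w k) \<le> \<lfloor>w * den_degree w k\<rfloor>"
    by (simp add: le_floor_iff)
  then show ?thesis
    by simp
qed

lemma den_degree_bounds:
  fixes w :: real
  assumes "w \<ge> 1"
  shows "w * den_degree w k \<le> den_degree w (Suc k)" "den_degree w (Suc k) \<le> w * den_degree w k + 1"
proof -
  have "w * den_degree w k \<ge> 0"
    using assms by simp
  then have "real (den_degree w (Suc k)) = real_of_int \<lfloor>w * den_degree w k\<rfloor> + 1"
    by simp
  then show "w * den_degree w k \<le> den_degree w (Suc k)" "den_degree w (Suc k) \<le> w * den_degree w k + 1"
    by linarith+
qed

text \<open>The set B encodes an infinite sequence of binary choices. For w \<ge> 1 the exponent is
  positive, so adding 1 changes neither degree nor leading coefficient.\<close>

definition partial_quotient :: "real \<Rightarrow> nat set \<Rightarrow> nat \<Rightarrow> 'a :: field poly" where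
  "partial_quotient w B i =
    monom 1 (den_degree w (Suc i) - den_degree w i) + (if i \<in> B then 1 else 0)"

lemma partial_quotient_monic:
  assumes "w \<ge> 1"
  shows "degree (partial_quotient w B i :: 'a :: field poly) = den_degree w (Suc i) - den_degree w i"
    and "lead_coeff (partial_quotient w B i :: 'a poly) = 1"
proof -
  let ?m = "monom 1 (den_degree w (Suc i) - den_degree w i) :: 'a poly"
  let ?c = "if i \<in> B then 1 else 0 :: 'a poly"
  have less: "degree ?c < degree ?m"
    using den_degree_less [OF assms, of i] by (simp add: degree_monom_eq)
  show "degree (partial_quotient w B i :: 'a poly) = den_degree w (Suc i) - den_degree w i"
    unfolding partial_quotient_def degree_add_eq_left [OF less] by (simp add: degree_monom_eq)
  show "lead_coeff (partial_quotient w B i :: 'a poly) = 1"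
    unfolding partial_quotient_def using lead_coeff_add_le [OF less]
    by (simp only: add.commute [of ?c] lead_coeff_monom)
qed

lemma degree_partial_quotient_pos:
  "w \<ge> 1 \<Longrightarrow> degree (partial_quotient w B i) > 0"
  unfolding partial_quotient_monic(1) using den_degree_less [of w i] by simp

text \<open>The degrees of the partial quotients telescope; in particular the result does not depend
  on B.\<close>

lemma degree_cf_den_partial_quotient:
  assumes "w \<ge> 1"
  shows "degree (cf_den (partial_quotient w B :: nat \<Rightarrow> 'a :: field poly) k) = den_degree w k"
proof -
  have "(\<Sum>i<k. degree (partial_quotient w B i :: 'a poly)) = den_degree w k"
    using den_degree_less [OF assms]
    by (induction k) (simp_all add: partial_quotient_monic [OF assms] less_imp_le del: den_degree.simps(2))
  then show ?thesis
    using cf_den_monic [of "partial_quotient w B :: nat \<Rightarrow> 'a poly" k]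
    by (simp add: partial_quotient_monic(2) [OF assms] degree_partial_quotient_pos [OF assms])
qed

lemma ex_good_approximations:
  assumes "w \<ge> 1"
  shows "\<exists>\<xi> :: 'a :: {field, finite} fls. good_approximations \<xi> w
    (cf_num (partial_quotient w B)) (cf_den (partial_quotient w B))"
proof -
  let ?a = "partial_quotient w B :: nat \<Rightarrow> 'a poly"
  have a: "lead_coeff (?a i) = 1" "degree (?a i) > 0" for i
    by (rule partial_quotient_monic(2) [OF assms], rule degree_partial_quotient_pos [OF assms])
  obtain \<xi> where \<xi>: "fls_abs \<xi> \<le> 1"
    "\<And>k. fls_abs (fls_of_poly_T (cf_den ?a k) * \<xi> - fls_of_poly_T (cf_num ?a k)) =
      1 / fls_abs (fls_of_poly_T (cf_den ?a (Suc k)))"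
    using cf_limit [of ?a] a by blast
  have "good_approximations \<xi> w (cf_num ?a) (cf_den ?a)"
  proof
    fix k
    show "lead_coeff (cf_den ?a k) = 1"
      using cf_den_monic [of ?a k] a by blast
    show "fls_abs (fls_of_poly_T (cf_num ?a k)) < fls_abs (fls_of_poly_T (cf_den ?a k))"
      using a by (rule cf_num_less_den)
    \<comment> \<open>The determinant is a Bezout identity up to the sign (-1)^k, which is absorbed
      into the coefficients.\<close>
    have "(- 1) ^ k * ((- 1) ^ k :: 'a poly) = 1"
      by (simp flip: power_mult_distrib)
    then have "(- ((- 1) ^ k * cf_den ?a (Suc k))) * cf_num ?a k +
        ((- 1) ^ k * cf_num ?a (Suc k)) * cf_den ?a k = 1"
      using cf_determinant [of ?a k] by (simp add: algebra_simps flip: right_diff_distrib)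
    then show "\<exists>b c. b * cf_num ?a k + c * cf_den ?a k = 1"
      by blast
    show "degree (cf_den ?a k) < degree (cf_den ?a (Suc k))"
      unfolding degree_cf_den_partial_quotient [OF assms] by (rule den_degree_less [OF assms])
    show "w * degree (cf_den ?a k) \<le> degree (cf_den ?a (Suc k))"
      "degree (cf_den ?a (Suc k)) \<le> w * degree (cf_den ?a k) + 1"
      unfolding degree_cf_den_partial_quotient [OF assms]
      by (rule den_degree_bounds [OF assms])+
  qed (use assms \<xi> in auto)
  then show ?thesis ..
qed

text \<open>Eliminating \<xi> from the two approximations of equal denominator degree bounds |p q' -
  p' q| strictly below 1, and a polynomial in T of that size is zero.\<close>

lemma good_approximations_cross:
  assumes "good_approximations \<xi> w p q" "good_approximations \<xi> w p' q'"
    and "degree (q k) = degree (q' k)"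
  shows "p k * q' k = p' k * q k"
proof -
  interpret A: good_approximations \<xi> w p q
    by fact
  interpret B: good_approximations \<xi> w p' q'
    by fact
  have A: "fls_abs (fls_of_poly_T (q' k) * (fls_of_poly_T (q k) * \<xi> - fls_of_poly_T (p k))) < 1"
    using A.degree_less [of k] assms(3) CARD_field_gt_1 [where 'a = 'a]
    by (simp only: fls_abs_mult A.approx) (simp add: fls_abs_of_poly_T divide_less_eq)
  have B: "fls_abs (fls_of_poly_T (q k) * (fls_of_poly_T (q' k) * \<xi> - fls_of_poly_T (p' k))) < 1"
    using B.degree_less [of k] assms(3) CARD_field_gt_1 [where 'a = 'a]
    by (simp only: fls_abs_mult B.approx) (simp add: fls_abs_of_poly_T divide_less_eq)
  have "fls_of_poly_T (p k * q' k - p' k * q k) =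
      fls_of_poly_T (q k) * (fls_of_poly_T (q' k) * \<xi> - fls_of_poly_T (p' k)) -
      fls_of_poly_T (q' k) * (fls_of_poly_T (q k) * \<xi> - fls_of_poly_T (p k))"
    by (simp add: algebra_simps)
  also have "fls_abs \<dots> < 1"
    using A B by (intro le_less_trans [OF fls_abs_diff_le]) simp
  finally have "fls_abs (fls_of_poly_T (p k * q' k - p' k * q k)) < 1" .
  then have "p k * q' k - p' k * q k = 0"
    using fls_abs_of_poly_T_ge_1 leD by blast
  then show ?thesis
    by simp
qed

text \<open>At the first index j where B and C differ, the cross determinant at j + 1 is
  \<plusminus>(c_j - b_j), which is nonzero, whereas \<open>good_approximations_cross\<close> makes
  it vanish.\<close>

lemma good_approximations_inj:
  assumes "w \<ge> 1"
    and "good_approximations (\<xi> :: 'a :: {field, finite} fls) w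
      (cf_num (partial_quotient w B)) (cf_den (partial_quotient w B))"
    and "good_approximations \<xi> w (cf_num (partial_quotient w C)) (cf_den (partial_quotient w C))"
  shows "B = C"
proof (rule ccontr)
  assume "B \<noteq> C"
  let ?b = "partial_quotient w B :: nat \<Rightarrow> 'a poly" and ?c = "partial_quotient w C :: nat \<Rightarrow> 'a poly"
  define j where "j = (LEAST j. (j \<in> B) \<noteq> (j \<in> C))"
  have "\<exists>j. (j \<in> B) \<noteq> (j \<in> C)"
    using \<open>B \<noteq> C\<close> by blast
  then have j: "(j \<in> B) \<noteq> (j \<in> C)"
    unfolding j_def by (rule LeastI_ex)
  have "(i \<in> B) = (i \<in> C)" if "i < j" for i
    using not_less_Least [of i "\<lambda>j. (j \<in> B) \<noteq> (j \<in> C)"] that by (simp add: j_def)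
  then have "?b i = ?c i" if "i < j" for i
    using that by (simp add: partial_quotient_def)
  then have "cf_num ?b (Suc j) * cf_den ?c (Suc j) - cf_num ?c (Suc j) * cf_den ?b (Suc j) =
      (- 1) ^ j * (?c j - ?b j)"
    by (rule cf_cross_determinant)
  moreover have "cf_num ?b (Suc j) * cf_den ?c (Suc j) = cf_num ?c (Suc j) * cf_den ?b (Suc j)"
    using assms by (intro good_approximations_cross) (simp_all only: degree_cf_den_partial_quotient)
  moreover have "?c j - ?b j \<noteq> 0"
    using j by (auto simp: partial_quotient_def)
  ultimately show False
    by simp
qed

section \<open>Uncountability and conclusion\<close>

lemma uncountable_UNIV_nat_set: "uncountable (UNIV :: nat set set)"
proof
  assume "countable (UNIV :: nat set set)"
  then have "range (from_nat_into (UNIV :: nat set set)) = UNIV"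
    by (intro range_from_nat_into) auto
  then show False
    using Cantors_theorem [of "UNIV :: nat set"] by (auto simp: image_def)
qed

theorem theorem2p7:
  fixes absv :: "'a :: {field, finite} fls alg_closure \<Rightarrow> real"
    and d :: nat and w :: real
  assumes "extends_fls_abs absv"
    and "d \<ge> 1"
    and "w \<ge> 2 * real d - 1"
  shows "uncountable {\<xi> :: 'a fls. \<forall>n\<in>{1..d}. w_exp n \<xi> = ereal w \<and> w_star_exp absv n \<xi> = ereal w}"
    (is "uncountable ?S")
proof
  assume S: "countable ?S"
  have w: "w \<ge> 1"
    using assms(2,3) by linarith
  have "\<forall>B. \<exists>\<xi> :: 'a fls. good_approximations \<xi> w
      (cf_num (partial_quotient w B)) (cf_den (partial_quotient w B))"
    using ex_good_approximations [OF w] by (rule allI)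
  from choice [OF this] obtain f :: "nat set \<Rightarrow> 'a fls" where f: "\<And>B. good_approximations (f B) w
      (cf_num (partial_quotient w B)) (cf_den (partial_quotient w B))"
    by blast
  have "f B \<in> ?S" for B
  proof -
    interpret good_approximations "f B" w "cf_num (partial_quotient w B)" "cf_den (partial_quotient w B)"
      by (rule f)
    \<comment> \<open>The hypothesis for d contains those for all smaller n, so one series serves
      all exponents at once.\<close>
    have "2 * real n - 1 \<le> w" if "n \<le> d" for n
      using that assms(3) by linarith
    then show ?thesis
      using w_exp_eq w_star_exp_eq [OF assms(1)] by simp
  qed
  then have "range f \<subseteq> ?S"
    by (rule image_subsetI)
  then have "countable (range f)"
    using S by (rule countable_subset)
  moreover have "inj f"
    using good_approximations_inj [OF w] f by (metis injI)
  ultimately show False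
    using countable_image_inj_on uncountable_UNIV_nat_set by blast
qed

end
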